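(* Let $H$ be a Hilbert $C^*$-module and $Q\in\mathcal{L}(H)$ a non-projection idempotent. Then the operators $(I-m(Q))Q$, $Q(I-m(Q))$, $(I-Q)m(Q)$, $m(Q)(I-Q)$ all have norm $\frac{\sqrt2}{2}\sqrt{\|Q\|(\|Q\|-1)}$. Furthermore, $$\big\|(m(Q)-Q)^2\big\|=\frac{\|Q\|-1}{2},\qquad \|m(Q)-Q\|=\frac12\Big(\|Q\|-1+\sqrt{\|Q\|^2-1}\Big).$$ Consequently, $$\sqrt2\,\big\|(m(Q)-Q)^2\big\|<\big\|(I-m(Q))Q\big\|<\|m(Q)-Q\|<\sqrt2\,\big\|(I-m(Q))Q\big\|.$$
   Context: $H$ is a Hilbert module over a $C^*$-algebra, $\mathcal{L}(H)$ the adjointable operators; a non-projection idempotent is $Q$ with $Q^2=Q\neq Q^*$. For $T$, $|T|=(T^*T)^{1/2}$ and $T^\dagger$ is the Moore–Penrose inverse (exists iff $\mathcal{R}(T)$ is closed). The matched projection of an idempotent $Q$ is $m(Q)=\tfrac12(|Q^*|+Q^* )|Q^*|^\dagger(|Q^*|+I)^{-1}(|Q^*|+Q)$. *)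

theory Defs
  imports Complex_Main
begin

text \<open>The adjointable operators L(H) on a Hilbert C*-module H form a unital (complex)
C*-algebra, and every unital C*-algebra A arises this way (A = L(A_A)).  We therefore
work in an abstract unital complex C*-algebra, given as a type class.\<close>

class cstar_algebra = banach + real_normed_algebra_1 +
  fixes scaleC :: "complex \<Rightarrow> 'a \<Rightarrow> 'a"
    and adj :: "'a \<Rightarrow> 'a"
  assumes scaleC_of_real: "scaleC (complex_of_real r) x = scaleR r x"
    and scaleC_add_left: "scaleC (a + b) x = scaleC a x + scaleC b x"
    and scaleC_add_right: "scaleC a (x + y) = scaleC a x + scaleC a y"
    and scaleC_scaleC: "scaleC a (scaleC b x) = scaleC (a * b) x"
    and scaleC_one: "scaleC 1 x = x"
    and norm_scaleC: "norm (scaleC a x) = cmod a * norm x"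
    and scaleC_mult_left: "scaleC a (x * y) = scaleC a x * y"
    and scaleC_mult_right: "scaleC a (x * y) = x * scaleC a y"
    and adj_adj: "adj (adj x) = x"
    and adj_add: "adj (x + y) = adj x + adj y"
    and adj_mult: "adj (x * y) = adj y * adj x"
    and adj_scaleC: "adj (scaleC a x) = scaleC (cnj a) (adj x)"
    and cstar_identity: "norm (adj x * x) = (norm x)\<^sup>2"

definition invertible_el :: "'a::cstar_algebra \<Rightarrow> bool" where
  "invertible_el x \<longleftrightarrow> (\<exists>y. x * y = 1 \<and> y * x = 1)"

definition inv_el :: "'a::cstar_algebra \<Rightarrow> 'a" where
  "inv_el x = (THE y. x * y = 1 \<and> y * x = 1)"

definition spectrum_el :: "'a::cstar_algebra \<Rightarrow> complex set" where
  "spectrum_el x = {z. \<not> invertible_el (x - scaleC z 1)}"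

definition positive_el :: "'a::cstar_algebra \<Rightarrow> bool" where
  "positive_el x \<longleftrightarrow> adj x = x \<and> spectrum_el x \<subseteq> complex_of_real ` {0..}"

definition sqrt_el :: "'a::cstar_algebra \<Rightarrow> 'a" where
  "sqrt_el x = (THE y. positive_el y \<and> y * y = x)"

definition abs_el :: "'a::cstar_algebra \<Rightarrow> 'a" where
  "abs_el T = sqrt_el (adj T * T)"

definition mp_inv :: "'a::cstar_algebra \<Rightarrow> 'a" where
  "mp_inv T = (THE X. T * X * T = T \<and> X * T * X = X \<and> adj (T * X) = T * X \<and> adj (X * T) = X * T)"

definition matched_proj :: "'a::cstar_algebra \<Rightarrow> 'a" where
  "matched_proj Q = scaleR (1/2)
     ((abs_el (adj Q) + adj Q) * mp_inv (abs_el (adj Q)) * inv_el (abs_el (adj Q) + 1)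
      * (abs_el (adj Q) + Q))"

end

theory Submission
  imports Defs "HOL-Analysis.Elementary_Normed_Spaces"
begin

text \<open>
  The element \<open>h = Q + Q\<^sup>* - 1\<close> is self-adjoint, and with \<open>k = Q - Q\<^sup>*\<close> one has \<open>h\<^sup>2 = 1 - k\<^sup>2 \<ge> 1\<close>
  and \<open>h k = - k h\<close>. Its modulus \<open>a = |h|\<close> commutes with \<open>Q\<close> and \<open>Q\<^sup>*\<close>, and \<open>|Q\<^sup>*| = P a\<close> for the range
  projection \<open>P = Q Q\<^sup>* a\<^bsup>-2\<^esup>\<close>. The formula for the matched projection then collapses to
  \<open>m(Q) = (1 + u) / 2\<close> with the symmetry \<open>u = h a\<^bsup>-1\<^esup>\<close>, and \<open>norm Q = norm a\<close>. In terms of \<open>u\<close>, \<open>k\<close>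
  and \<open>a\<close> the operators become explicit: \<open>(m - Q)\<^sup>2 = (1 - a) / 2\<close>, the four products have squared
  moduli that are corners of \<open>(a\<^sup>2 - a) / 2\<close>, and \<open>2 (m - Q) u = 1 - (a + w)\<close> where \<open>w = k u\<close> is
  self-adjoint with \<open>w\<^sup>2 = a\<^sup>2 - 1\<close>.
\<close>

subsection \<open>The involution\<close>

lemma adj_zero [simp]: "adj (0::'a::cstar_algebra) = 0"
  using adj_add[of "0::'a" 0] by simp

lemma adj_minus [simp]: "adj (- x) = - adj (x::'a::cstar_algebra)"
  using adj_add[of x "- x"] by (simp add: eq_neg_iff_add_eq_0 add.commute)

lemma adj_diff: "adj (x - y) = adj x - adj (y::'a::cstar_algebra)"
  using adj_add[of x "- y"] by simp

lemma adj_one [simp]: "adj (1::'a::cstar_algebra) = 1"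
  using adj_mult[of "adj (1::'a)" 1] by (simp add: adj_adj)

lemma adj_scaleR: "adj (r *\<^sub>R x) = r *\<^sub>R adj (x::'a::cstar_algebra)"
  using adj_scaleC[of "complex_of_real r" x] by (simp add: scaleC_of_real)

lemma adj_of_real [simp]: "adj (of_real r :: 'a::cstar_algebra) = of_real r"
  by (simp add: of_real_def adj_scaleR)

lemmas adj_simps = adj_adj adj_add adj_diff adj_mult adj_scaleR

lemma norm_adj [simp]: "norm (adj x) = norm (x::'a::cstar_algebra)"
proof -
  have *: "norm y \<le> norm (adj y)" for y :: 'a
  proof (cases "y = 0")
    case False
    have "norm y * norm y \<le> norm (adj y) * norm y"
      using cstar_identity[of y] norm_mult_ineq[of "adj y" y] by (simp add: power2_eq_square)
    then show ?thesis using False by simp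
  qed simp
  show ?thesis using *[of x] *[of "adj x"] by (simp add: adj_adj)
qed

lemma norm_mult_adj: "norm (x * adj x) = (norm (x::'a::cstar_algebra))\<^sup>2"
  using cstar_identity[of "adj x"] by (simp add: adj_adj)

lemma norm_selfadjoint_square:
  "adj x = x \<Longrightarrow> norm (x * x) = (norm (x::'a::cstar_algebra))\<^sup>2"
  using cstar_identity[of x] by simp

lemma bounded_linear_adj: "bounded_linear (adj :: 'a::cstar_algebra \<Rightarrow> 'a)"
  by (rule bounded_linear_intro[where K = 1]) (simp_all add: adj_simps)

lemma scaleC_minus_left: "scaleC (- c) x = - scaleC c (x::'a::cstar_algebra)"
  using scaleC_add_left[of c "- c" x] scaleC_of_real[of 0 x]
  by (simp add: eq_neg_iff_add_eq_0 add.commute)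

lemma scaleC_minus_right: "scaleC c (- x) = - scaleC c (x::'a::cstar_algebra)"
proof -
  have "scaleC c (0::'a) = 0" using scaleC_add_right[of c 0 0] by simp
  then show ?thesis
    using scaleC_add_right[of c "- x" x] by (simp add: eq_neg_iff_add_eq_0)
qed

lemma scaleC_diff_right: "scaleC c (x - y) = scaleC c x - scaleC c (y::'a::cstar_algebra)"
  using scaleC_add_right[of c x "- y"] by (simp add: scaleC_minus_right)

lemma scaleC_mult_scaleC:
  "scaleC c x * scaleC d y = scaleC (c * d) (x * (y::'a::cstar_algebra))"
  by (simp add: scaleC_mult_left[symmetric] scaleC_mult_right[symmetric] scaleC_scaleC
      mult.commute)

subsection \<open>Norms of powers of self-adjoint elements\<close>

lemma adj_power: "adj (x ^ n) = adj (x::'a::cstar_algebra) ^ n"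
  by (induction n) (simp_all add: adj_mult power_commutes)

lemma norm_selfadjoint_power:
  fixes x :: "'a::cstar_algebra"
  assumes "adj x = x"
  shows "norm (x ^ (2 ^ k)) = norm x ^ (2 ^ k)"
proof (induction k)
  case (Suc k)
  have "norm (x ^ (2 ^ k) * x ^ (2 ^ k)) = (norm (x ^ (2 ^ k)))\<^sup>2"
    by (rule norm_selfadjoint_square) (simp add: adj_power assms)
  then show ?case
    using Suc by (simp add: mult_2 power_add power2_eq_square)
qed simp

text \<open>If the ratio \<open>s / t\<close> exceeded 1, its powers would outgrow \<open>C\<close>.
  This removes constant factors from bounds on \<open>norm (x ^ (2 ^ k))\<close>, which for
  self-adjoint \<open>x\<close> determines \<open>norm x\<close>.\<close>

lemma le_of_dyadic_powers_le:
  fixes s t C :: real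
  assumes "0 \<le> t" and le: "\<And>k. s ^ (2 ^ k) \<le> C * t ^ (2 ^ k)"
  shows "s \<le> t"
proof (rule ccontr)
  assume "\<not> s \<le> t"
  then have st: "t < s" by simp
  show False
  proof (cases "t = 0")
    case True
    then show False using le[of 0] st by simp
  next
    case False
    then have t: "0 < t" using assms by simp
    define q where "q = s / t"
    have q: "q > 1" using st t by (simp add: q_def)
    obtain n where n: "C < q ^ n" using real_arch_pow[OF q] by blast
    have "q ^ n \<le> q ^ (2 ^ n)"
      using q by (intro power_increasing) (auto intro: less_imp_le)
    also have "\<dots> \<le> C"
      using le[of n] t by (simp add: q_def power_divide divide_le_eq)
    finally show False using n by simp
  qed
qed

text \<open>A substitute for the equality of spectral radii:
  \<open>(x * y) ^ Suc n = x * (y * x) ^ n * y\<close>, and self-adjointness of both products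
  recovers their norms from dyadic powers.\<close>

lemma norm_mult_commute_le:
  fixes x y :: "'a::cstar_algebra"
  assumes xy: "adj (x * y) = x * y" and yx: "adj (y * x) = y * x"
  shows "norm (x * y) \<le> norm (y * x)"
proof (cases "y * x = 0")
  case True
  \<comment> \<open>The square is \<open>x * (y * x) * y\<close>. This case is split off because the
    constant used below divides by \<open>norm (y * x)\<close>.\<close>
  have "norm ((x * y) * (x * y)) = 0"
    using True by (metis mult.assoc mult_zero_left mult_zero_right norm_zero)
  then show ?thesis using norm_selfadjoint_square[OF xy] by simp
next
  case False
  have pow: "(x * y) ^ Suc n = x * (y * x) ^ n * y" for n
  proof (induction n)
    case (Suc n)
    have "(x * y) ^ Suc (Suc n) = (x * (y * x) ^ n * y) * (x * y)"
      using Suc by (metis power_Suc2)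
    then show ?case by (simp only: mult.assoc power_Suc2)
  qed simp
  have "norm (x * y) ^ (2 ^ k) \<le> (norm x * norm y / norm (y * x)) * norm (y * x) ^ (2 ^ k)" for k
  proof -
    obtain n where n: "(2::nat) ^ k = Suc n"
      using not0_implies_Suc[of "2 ^ k"] by auto
    have "norm (x * y) ^ (2 ^ k) = norm (x * (y * x) ^ n * y)"
      using norm_selfadjoint_power[OF xy, of k] by (metis n pow)
    also have "\<dots> \<le> norm x * norm (y * x) ^ n * norm y"
      by (meson norm_ge_zero norm_mult_ineq norm_power_ineq mult_left_mono mult_right_mono order_trans)
    also have "\<dots> = (norm x * norm y / norm (y * x)) * norm (y * x) ^ (2 ^ k)"
      using False by (simp add: n)
    finally show ?thesis .
  qed
  then show ?thesis by (rule le_of_dyadic_powers_le[OF norm_ge_zero])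
qed

text \<open>Powers of an orthogonal sum split termwise, so the triangle inequality costs only a
  factor 2 at every exponent, and dyadic roots remove it.\<close>

lemma norm_add_orthogonal_le:
  fixes b c :: "'a::cstar_algebra"
  assumes b: "adj b = b" and c: "adj c = c" and bc: "b * c = 0"
  shows "norm (b + c) \<le> max (norm b) (norm c)"
proof -
  have cb: "c * b = 0"
    using arg_cong[OF bc, of adj] by (simp add: adj_mult b c)
  have pow: "(b + c) ^ Suc n = b ^ Suc n + c ^ Suc n" for n
  proof (induction n)
    case (Suc n)
    have "(b + c) ^ Suc (Suc n) = (b + c) * (b ^ Suc n + c ^ Suc n)"
      using Suc by simp
    moreover have "b * c ^ Suc n = 0" "c * b ^ Suc n = 0"
      using bc cb by (simp_all add: mult.assoc[symmetric])
    ultimately show ?case by (simp add: distrib_left distrib_right)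
  qed simp
  have "norm (b + c) ^ (2 ^ k) \<le> 2 * max (norm b) (norm c) ^ (2 ^ k)" for k
  proof -
    obtain n where n: "(2::nat) ^ k = Suc n"
      using not0_implies_Suc[of "2 ^ k"] by auto
    have "norm (b + c) ^ (2 ^ k) = norm (b ^ (2 ^ k) + c ^ (2 ^ k))"
      using norm_selfadjoint_power[of "b + c" k] by (simp add: adj_add b c n pow del: power_Suc)
    also have "\<dots> \<le> norm b ^ (2 ^ k) + norm c ^ (2 ^ k)"
      by (meson norm_triangle_le add_mono norm_power_ineq)
    also have "\<dots> \<le> max (norm b) (norm c) ^ (2 ^ k) + max (norm b) (norm c) ^ (2 ^ k)"
      by (intro add_mono power_mono) auto
    finally show ?thesis by simp
  qed
  moreover have "0 \<le> max (norm b) (norm c)" by (simp add: le_max_iff_disj)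
  ultimately show ?thesis by (rule le_of_dyadic_powers_le[rotated])
qed

subsection \<open>Invertibility and real spectrum\<close>

lemma invertible_elI: "x * y = 1 \<Longrightarrow> y * x = 1 \<Longrightarrow> invertible_el x"
  by (auto simp: invertible_el_def)

lemma inv_el_eqI:
  fixes x y :: "'a::cstar_algebra"
  assumes "x * y = 1" "y * x = 1"
  shows "inv_el x = y"
  unfolding inv_el_def
proof (rule the_equality)
  fix z assume "x * z = 1 \<and> z * x = 1"
  then show "z = y" using assms by (metis mult.assoc mult_1_left mult_1_right)
qed (use assms in auto)

lemma invertible_one_minus:
  fixes x :: "'a::cstar_algebra"
  assumes "norm x < 1"
  shows "invertible_el (1 - x)"
proof -
  have sm: "summable (\<lambda>n. x ^ n)"
    by (rule complete_algebra_summable_geometric[OF assms])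
  let ?y = "\<Sum>n. x ^ n"
  have "?y = 1 + (\<Sum>n. x ^ Suc n)" using suminf_split_head[OF sm] by simp
  moreover have "(\<Sum>n. x ^ Suc n) = x * ?y" using suminf_mult[OF sm, of x] by simp
  moreover have "(\<Sum>n. x ^ Suc n) = ?y * x"
    using suminf_mult2[OF sm, of x] by (simp add: power_commutes)
  ultimately show ?thesis
    by (intro invertible_elI[where y = ?y]) (simp_all add: algebra_simps)
qed

lemma invertible_scaleC:
  assumes "c \<noteq> 0" "invertible_el (x::'a::cstar_algebra)"
  shows "invertible_el (scaleC c x)"
proof -
  obtain y where "x * y = 1" "y * x = 1" using assms by (auto simp: invertible_el_def)
  then show ?thesis
    using assms(1)
    by (intro invertible_elI[where y = "scaleC (1 / c) y"])
      (simp_all add: scaleC_mult_scaleC scaleC_one)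
qed

lemma invertible_minus_scaleC:
  fixes x :: "'a::cstar_algebra"
  assumes "norm x < cmod c"
  shows "invertible_el (x - scaleC c 1)"
proof -
  have c: "c \<noteq> 0" using assms by (metis norm_ge_zero norm_zero not_le)
  have "norm (scaleC (1 / c) x) < 1"
    using assms c by (simp add: norm_scaleC norm_divide)
  then have "invertible_el (scaleC (- c) (1 - scaleC (1 / c) x))"
    using c by (intro invertible_scaleC invertible_one_minus) auto
  moreover have "scaleC (- c) (1 - scaleC (1 / c) x) = x - scaleC c 1"
    using c by (simp add: scaleC_diff_right scaleC_scaleC scaleC_minus_left scaleC_one)
  ultimately show ?thesis by simp
qed

text \<open>Arens' trick: far along the imaginary axis, the self-adjoint summand
  only changes the norm to second order.\<close>

lemma invertible_selfadjoint_minus_nonreal: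
  fixes x :: "'a::cstar_algebra"
  assumes x: "adj x = x" and z: "Im z \<noteq> 0"
  shows "invertible_el (x - scaleC z 1)"
proof -
  define y where "y = x - Re z *\<^sub>R 1"
  \<comment> \<open>Chosen so that the cross term of \<open>(Im z + t)^2\<close> is
    \<open>2 * (norm y)^2\<close>, which together with \<open>(Im z)^2 > 0\<close> beats
    \<open>(norm y)^2 + t^2\<close>.\<close>
  define t where "t = (norm y)\<^sup>2 / Im z"
  have y: "adj y = y" by (simp add: y_def adj_simps x)
  have adjv: "adj (y + scaleC (\<i> * t) 1) = y - scaleC (\<i> * t) 1"
    by (simp add: adj_simps adj_scaleC y scaleC_minus_left)
  have "(norm (y + scaleC (\<i> * t) 1))\<^sup>2
      = norm ((y - scaleC (\<i> * t) 1) * (y + scaleC (\<i> * t) 1))"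
    by (simp add: cstar_identity[symmetric] adjv)
  also have "(y - scaleC (\<i> * t) 1) * (y + scaleC (\<i> * t) 1)
      = y * y + scaleC (complex_of_real (t * t)) 1"
    by (simp add: algebra_simps scaleC_mult_scaleC scaleC_mult_left[symmetric]
        scaleC_mult_right[symmetric] scaleC_minus_left scaleC_diff_right scaleC_scaleC)
  also have "norm \<dots> \<le> (norm y)\<^sup>2 + t\<^sup>2"
    by (rule norm_triangle_le)
      (simp add: norm_selfadjoint_square y scaleC_of_real power2_eq_square abs_mult del: of_real_mult)
  also have "\<dots> < (Im z + t)\<^sup>2"
  proof -
    have "(Im z + t)\<^sup>2 = (Im z)\<^sup>2 + 2 * (norm y)\<^sup>2 + t\<^sup>2"
      using z by (simp add: power2_sum t_def)
    moreover have "(Im z)\<^sup>2 > 0" using z by simp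
    ultimately show ?thesis by (smt (verit) zero_le_power2)
  qed
  also have "\<dots> = (cmod (\<i> * (Im z + t)))\<^sup>2"
    by (simp add: norm_mult flip: of_real_add)
  finally have "norm (y + scaleC (\<i> * t) 1) < cmod (\<i> * (Im z + t))"
    by (rule power2_less_imp_less) simp
  then have "invertible_el (y + scaleC (\<i> * t) 1 - scaleC (\<i> * (Im z + t)) 1)"
    by (rule invertible_minus_scaleC)
  moreover have "scaleC z (1::'a) = Re z *\<^sub>R 1 + scaleC (\<i> * Im z) 1"
    by (subst complex_eq[of z]) (simp add: scaleC_add_left scaleC_of_real)
  then have "y + scaleC (\<i> * t) 1 - scaleC (\<i> * (Im z + t)) 1 = x - scaleC z 1"
    by (simp add: y_def distrib_left scaleC_add_left)
  ultimately show ?thesis by simp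
qed

subsection \<open>Square roots by a fixed point argument\<close>

text \<open>A fixed point of \<open>y \<mapsto> (x + y\<^sup>2) / 2\<close> satisfies \<open>(1 - y)\<^sup>2 = 1 - x\<close>; the map
  contracts the ball of radius \<open>1 - sqrt (1 - norm x)\<close>.\<close>

lemma ex_sqrt_one_minus:
  fixes x :: "'a::cstar_algebra"
  assumes x: "adj x = x" "norm x < 1"
  obtains y where "adj y = y" "norm y < 1" "(1 - y) * (1 - y) = 1 - x"
    "\<And>z. z * x = x * z \<Longrightarrow> z * y = y * z"
proof -
  \<comment> \<open>The smaller root of \<open>r = (norm x + r * r) / 2\<close>: the radius of an
    invariant ball and, being below 1, the contraction factor.\<close>
  define r where "r = 1 - sqrt (1 - norm x)"
  have r: "0 \<le> r" "r < 1" using x by (auto simp: r_def)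
  have rr: "(norm x + r * r) / 2 = r"
  proof -
    have "(1 - r) * (1 - r) = 1 - norm x" using x by (simp add: r_def)
    then show ?thesis by (simp add: algebra_simps)
  qed
  \<comment> \<open>The commutation clause is closed and preserved by \<open>f\<close>, so the fixed
    point commutes with everything that commutes with \<open>x\<close>.\<close>
  define S where "S = {y. adj y = y \<and> norm y \<le> r \<and> (\<forall>z. z * x = x * z \<longrightarrow> z * y = y * z)}"
  define f where "f y = (1/2) *\<^sub>R (x + y * y)" for y
  have "closed S"
    unfolding S_def
    by (intro closed_Collect_conj closed_Collect_all closed_Collect_imp closed_Collect_eq
        closed_Collect_le continuous_intros bounded_linear.continuous_on[OF bounded_linear_adj]) auto
  then have "complete S" by (simp add: complete_eq_closed)
  moreover have "S \<noteq> {}" using r by (auto simp: S_def intro!: exI[of _ 0])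
  moreover have "f ` S \<subseteq> S"
  proof clarify
    fix y assume "y \<in> S"
    then have y: "adj y = y" "norm y \<le> r" "\<And>z. z * x = x * z \<Longrightarrow> z * y = y * z"
      unfolding S_def by blast+
    have "norm (x + y * y) \<le> norm x + norm y * norm y"
      by (meson norm_triangle_le add_left_mono norm_mult_ineq)
    also have "\<dots> \<le> norm x + r * r"
      using y(2) by (intro add_left_mono mult_mono) (auto simp: r)
    finally have "norm (f y) \<le> r" using rr by (simp add: f_def)
    moreover have "adj (f y) = f y" by (simp add: f_def adj_simps x y(1))
    moreover have "z * f y = f y * z" if "z * x = x * z" for z
    proof -
      have "z * (y * y) = y * y * z" using y(3)[OF that] by (metis mult.assoc)
      then show ?thesis using that by (simp add: f_def distrib_left distrib_right)
    qed
    ultimately show "f y \<in> S" unfolding S_def by blast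
  qed
  moreover have "dist (f y) (f z) \<le> r * dist y z" if "y \<in> S" "z \<in> S" for y z
  proof -
    have yz: "norm y \<le> r" "norm z \<le> r" using that unfolding S_def by blast+
    have "f y - f z = (1/2) *\<^sub>R (y * (y - z) + (y - z) * z)"
      by (simp add: f_def algebra_simps)
    then have "norm (f y - f z) \<le> (1/2) * (norm y * norm (y - z) + norm (y - z) * norm z)"
      by (simp add: norm_triangle_le add_mono norm_mult_ineq)
    also have "\<dots> \<le> (1/2) * (r * norm (y - z) + norm (y - z) * r)"
      using yz by (intro mult_left_mono add_mono mult_right_mono) auto
    finally show ?thesis by (simp add: dist_norm)
  qed
  ultimately obtain y where y: "y \<in> S" "f y = y"
    using Banach_fix[of S r f] r by blast
  have "y + y = x + y * y"
    using arg_cong[OF y(2), of "\<lambda>y. 2 *\<^sub>R y"] by (simp add: f_def scaleR_2)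
  then have "(1 - y) * (1 - y) = 1 - x" by (simp add: algebra_simps)
  moreover have "adj y = y" "norm y \<le> r" "\<And>z. z * x = x * z \<Longrightarrow> z * y = y * z"
    using y(1) unfolding S_def by blast+
  ultimately show ?thesis using that r by (meson le_less_trans)
qed

text \<open>Factor \<open>p\<^sup>2 + q\<^sup>2\<close> as \<open>(p + \<i> q)\<^sup>* (p + \<i> q)\<close>.\<close>

lemma norm_square_le_norm_sum_squares:
  fixes p q :: "'a::cstar_algebra"
  assumes p: "adj p = p" and q: "adj q = q" and pq: "p * q = q * p"
  shows "(norm p)\<^sup>2 \<le> norm (p * p + q * q)"
proof -
  define v where "v = p + scaleC \<i> q"
  have adjv: "adj v = p - scaleC \<i> q"
    by (simp add: v_def adj_simps adj_scaleC p q scaleC_minus_left)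
  have "adj v * v = p * p + q * q"
    unfolding adjv
    by (simp add: v_def algebra_simps scaleC_mult_scaleC scaleC_mult_left[symmetric]
        scaleC_mult_right[symmetric] scaleC_minus_left scaleC_one scaleC_diff_right scaleC_scaleC pq)
  then have nv: "(norm v)\<^sup>2 = norm (p * p + q * q)" using cstar_identity[of v] by simp
  have "2 *\<^sub>R p = v + adj v" unfolding adjv by (simp add: v_def scaleR_2)
  then have "2 * norm p \<le> norm v + norm v"
    by (metis norm_adj norm_scaleR norm_triangle_ineq abs_numeral)
  then have "(norm p)\<^sup>2 \<le> (norm v)\<^sup>2" by (intro power_mono) auto
  then show ?thesis using nv by simp
qed

subsection \<open>Positivity in terms of the norm\<close>

text \<open>This description of positivity is equivalent to the spectral one and makes the
  cone property immediate.\<close>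

definition norm_pos :: "'a::cstar_algebra \<Rightarrow> bool" where
  "norm_pos x \<longleftrightarrow> adj x = x \<and> (\<exists>t. norm (of_real t - x) \<le> t)"

lemma norm_pos_adj: "norm_pos x \<Longrightarrow> adj x = x"
  by (simp add: norm_pos_def)

lemma norm_posI: "adj x = x \<Longrightarrow> norm (of_real t - x) \<le> t \<Longrightarrow> norm_pos x"
  by (auto simp: norm_pos_def)

lemma of_real_commute: "of_real r * x = x * (of_real r :: 'a::real_algebra_1)"
  by (simp add: of_real_def)

text \<open>With \<open>T = t + e\<close> one has
  \<open>z + of_real e = T *\<^sub>R (1 - x)\<close>, where the shift forces
  \<open>norm x < 1\<close>; the root of \<open>1 - x\<close> is then rescaled by
  \<open>sqrt T\<close>.\<close>

lemma ex_sqrt_shift: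
  fixes z :: "'a::cstar_algebra"
  assumes z: "norm_pos z" and e: "0 < e"
  obtains q where "norm_pos q" "invertible_el q" "q * q = z + of_real e"
    "\<And>c. c * z = z * c \<Longrightarrow> c * q = q * c"
proof -
  obtain t where t: "norm (of_real t - z) \<le> t" using z by (auto simp: norm_pos_def)
  then have t0: "0 \<le> t" using norm_ge_zero order_trans by blast
  define T where "T = t + e"
  have T: "0 < T" "t < T" using t0 e by (auto simp: T_def)
  define x where "x = (1 / T) *\<^sub>R (of_real t - z)"
  have x: "adj x = x" "norm x < 1"
    using t T by (auto simp: x_def adj_simps norm_pos_adj[OF z])
  obtain y where y: "adj y = y" "norm y < 1" "(1 - y) * (1 - y) = 1 - x"
    "\<And>c. c * x = x * c \<Longrightarrow> c * y = y * c"
    using ex_sqrt_one_minus[OF x] by blast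
  define q where "q = sqrt T *\<^sub>R (1 - y)"
  have "of_real (sqrt T) - q = sqrt T *\<^sub>R y"
    by (simp add: q_def of_real_def scaleR_diff_right)
  then have "norm (of_real (sqrt T) - q) \<le> sqrt T"
    using T y(2) by (simp add: mult_left_le)
  then have "norm_pos q"
    by (auto simp: norm_pos_def q_def adj_simps y(1))
  moreover have "invertible_el q"
    using invertible_scaleC[OF _ invertible_one_minus[OF y(2)], of "complex_of_real (sqrt T)"] T
    by (simp add: q_def scaleC_of_real)
  moreover have "q * q = z + of_real e"
  proof -
    have "q * q = T *\<^sub>R (1 - x)" using T by (simp add: q_def y(3))
    also have "\<dots> = z + of_real e"
      using T by (simp add: x_def scaleR_diff_right) (simp add: of_real_def T_def scaleR_add_left)
    finally show ?thesis .
  qed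
  moreover have "c * q = q * c" if "c * z = z * c" for c
  proof -
    have "c * x = x * c"
      using that by (simp add: x_def left_diff_distrib right_diff_distrib of_real_commute)
    from y(4)[OF this] show ?thesis
      by (simp add: q_def left_diff_distrib right_diff_distrib)
  qed
  ultimately show ?thesis using that by blast
qed

text \<open>The element \<open>of_real t - x * x\<close> is a square \<open>p * p\<close> with
  \<open>p\<close> commuting with \<open>x\<close>. Since \<open>p * p + x * x\<close> is the scalar
  \<open>t\<close>, the sum-of-squares bound applies.\<close>

lemma norm_of_real_minus_square_le:
  fixes x :: "'a::cstar_algebra"
  assumes x: "adj x = x" and t: "(norm x)\<^sup>2 < t"
  shows "norm (of_real t - x * x) \<le> t"
proof -
  have t0: "0 < t" using t by (smt (verit) zero_le_power2)
  define x' where "x' = (1 / t) *\<^sub>R (x * x)"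
  have x': "adj x' = x'" "norm x' < 1"
    using t t0 by (auto simp: x'_def adj_simps x norm_selfadjoint_square)
  obtain y where y: "adj y = y" "(1 - y) * (1 - y) = 1 - x'"
    "\<And>c. c * x' = x' * c \<Longrightarrow> c * y = y * c"
    using ex_sqrt_one_minus[OF x'] by blast
  define p where "p = sqrt t *\<^sub>R (1 - y)"
  have p: "adj p = p" by (simp add: p_def adj_simps y(1))
  have pp: "p * p = of_real t - x * x"
  proof -
    have "p * p = t *\<^sub>R (1 - x')" using t0 by (simp add: p_def y(2))
    then show ?thesis using t0 by (simp add: x'_def scaleR_diff_right of_real_def)
  qed
  have "x * y = y * x" by (rule y(3)) (simp add: x'_def mult.assoc)
  then have "p * x = x * p" by (simp add: p_def left_diff_distrib right_diff_distrib)
  from norm_square_le_norm_sum_squares[OF p x this]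
  show ?thesis using t0 norm_selfadjoint_square[OF p] by (simp add: pp)
qed

lemma norm_pos_square: "adj x = x \<Longrightarrow> norm_pos (x * (x::'a::cstar_algebra))"
  by (rule norm_posI[OF _ norm_of_real_minus_square_le[of x "(norm x)\<^sup>2 + 1"]])
    (simp_all add: adj_mult)

lemma norm_pos_add:
  assumes "norm_pos x" "norm_pos y"
  shows "norm_pos (x + (y::'a::cstar_algebra))"
proof -
  obtain s t where st: "norm (of_real s - x) \<le> s" "norm (of_real t - y) \<le> t"
    using assms by (auto simp: norm_pos_def)
  have "of_real (s + t) - (x + y) = (of_real s - x) + (of_real t - y)" by simp
  then have "norm (of_real (s + t) - (x + y)) \<le> s + t"
    using st by (metis norm_triangle_mono)
  then show ?thesis
    using assms by (intro norm_posI[of "x + y" "s + t"]) (simp_all add: adj_add norm_pos_adj)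
qed

lemma norm_pos_of_real_iff: "norm_pos (of_real r :: 'a::cstar_algebra) \<longleftrightarrow> 0 \<le> r"
proof -
  have "norm (of_real t - of_real r :: 'a) = \<bar>t - r\<bar>" for t
    by (metis norm_of_real of_real_diff)
  then show ?thesis by (auto simp: norm_pos_def intro: exI[of _ r])
qed

lemma norm_pos_of_real_minus:
  "adj x = x \<Longrightarrow> norm x \<le> t \<Longrightarrow> norm_pos (of_real t - (x::'a::cstar_algebra))"
  by (auto simp: norm_pos_def adj_diff intro!: exI[of _ t])

text \<open>The definition of \<open>norm_pos\<close> provides some witness; here every
  \<open>t\<close> above \<open>norm z\<close> becomes one, by writing \<open>z + of_real d\<close>
  as a square and letting \<open>d\<close> shrink.\<close>

lemma norm_of_real_minus_le:
  fixes z :: "'a::cstar_algebra"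
  assumes z: "norm_pos z" and t: "norm z < t"
  shows "norm (of_real t - z) \<le> t"
proof (rule field_le_epsilon)
  fix e :: real assume e: "0 < e"
  define d where "d = min e (t - norm z) / 2"
  have d: "0 < d" "d < e" "norm z + d < t"
    using e t by (auto simp: d_def min_def field_simps)
  obtain q where q: "norm_pos q" "q * q = z + of_real d"
    using ex_sqrt_shift[OF z d(1)] by blast
  have "(norm q)\<^sup>2 \<le> norm z + d"
    using norm_selfadjoint_square[OF norm_pos_adj[OF q(1)]] norm_triangle_ineq[of z "of_real d"] d
    by (simp add: q(2))
  then have "norm (of_real t - (z + of_real d)) \<le> t"
    using norm_of_real_minus_square_le[OF norm_pos_adj[OF q(1)], of t] d by (simp add: q(2))
  moreover have "of_real t - z = (of_real t - (z + of_real d)) + of_real d" by simp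
  ultimately show "norm (of_real t - z) \<le> t + e"
    using d norm_triangle_ineq[of "of_real t - (z + of_real d)" "of_real d"] by simp
qed

text \<open>The single witness \<open>norm z + 1\<close> serves all approximants close enough to
  \<open>z\<close>, so its inequality survives the limit.\<close>

lemma norm_pos_closed:
  fixes z :: "'a::cstar_algebra"
  assumes z: "adj z = z" and C: "0 \<le> C"
    and approx: "\<And>e. 0 < e \<Longrightarrow> \<exists>x. norm_pos x \<and> norm (x - z) \<le> C * e"
  shows "norm_pos z"
proof -
  have "norm (of_real (norm z + 1) - z) \<le> norm z + 1"
  proof (rule field_le_epsilon)
    fix e :: real assume e: "0 < e"
    \<comment> \<open>Dividing by \<open>C + 1\<close> covers \<open>C = 0\<close>; the cap
      \<open>1/2\<close> keeps the approximant's norm below \<open>norm z + 1\<close>.\<close>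
    define d where "d = min e (1/2) / (C + 1)"
    have d: "0 < d" using e C by (simp add: d_def)
    have "C * d \<le> (C + 1) * d" using d by (intro mult_right_mono) auto
    also have "\<dots> = min e (1/2)" using C by (simp add: d_def)
    finally have Cd: "C * d \<le> e" "C * d < 1" by auto
    obtain x where x: "norm_pos x" "norm (x - z) \<le> C * d" using approx[OF d] by blast
    have "norm x < norm z + 1"
      using norm_triangle_ineq[of z "x - z"] x Cd by simp
    from norm_of_real_minus_le[OF x(1) this]
    show "norm (of_real (norm z + 1) - z) \<le> norm z + 1 + e"
      using norm_triangle_ineq[of "of_real (norm z + 1) - x" "x - z"] x(2) Cd by simp
  qed
  then show ?thesis by (rule norm_posI[OF z])
qed

text \<open>After a shift by \<open>e\<close>, \<open>z\<close> becomes a square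
  \<open>q * q\<close> with \<open>q\<close> commuting with \<open>r\<close>, so the product is the
  square of \<open>q * r\<close>; closedness lets \<open>e\<close> tend to 0.\<close>

lemma norm_pos_mult_square:
  fixes z r :: "'a::cstar_algebra"
  assumes z: "norm_pos z" and r: "adj r = r" and zr: "z * r = r * z"
  shows "norm_pos (z * (r * r))"
proof (rule norm_pos_closed[where C = "norm (r * r)"])
  have "z * (r * r) = r * r * z" using zr by (metis mult.assoc)
  then show "adj (z * (r * r)) = z * (r * r)" by (simp add: adj_mult r norm_pos_adj[OF z])
  fix e :: real assume e: "0 < e"
  obtain q where q: "norm_pos q" "q * q = z + of_real e" "r * q = q * r"
    using ex_sqrt_shift[OF z e] zr by metis
  have "(q * r) * (q * r) = (q * q) * (r * r)" using q(3) by (metis mult.assoc)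
  also have "\<dots> = z * (r * r) + e *\<^sub>R (r * r)" by (simp add: q(2) distrib_right of_real_def)
  finally have eq: "(q * r) * (q * r) = z * (r * r) + e *\<^sub>R (r * r)" .
  have "adj (q * r) = q * r" by (simp add: adj_mult r norm_pos_adj[OF q(1)] q(3))
  then have "norm_pos ((q * r) * (q * r))" by (rule norm_pos_square)
  then show "\<exists>x. norm_pos x \<and> norm (x - z * (r * r)) \<le> norm (r * r) * e"
    using e by (intro exI[of _ "(q * r) * (q * r)"]) (simp add: eq)
qed simp

lemma norm_pos_mult:
  fixes x y :: "'a::cstar_algebra"
  assumes x: "norm_pos x" and y: "norm_pos y" and xy: "x * y = y * x"
  shows "norm_pos (x * y)"
proof (rule norm_pos_closed[where C = "norm x"])
  show "adj (x * y) = x * y" by (simp add: adj_mult norm_pos_adj[OF x] norm_pos_adj[OF y] xy)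
  fix e :: real assume e: "0 < e"
  obtain r where r: "norm_pos r" "r * r = y + of_real e" "x * r = r * x"
    using ex_sqrt_shift[OF y e] xy by metis
  have "norm_pos (x * (r * r))"
    by (rule norm_pos_mult_square[OF x norm_pos_adj[OF r(1)] r(3)])
  then show "\<exists>z. norm_pos z \<and> norm (z - x * y) \<le> norm x * e"
    using e by (intro exI[of _ "x * (r * r)"]) (simp add: r(2) distrib_left of_real_def mult.commute)
qed simp

text \<open>Slightly shifted, \<open>z\<close> and \<open>of_real t - z\<close> are squares of
  commuting elements whose sum is a scalar, so the sum-of-squares bound turns an order estimate into
  a norm estimate.\<close>

lemma norm_le_of_norm_pos:
  fixes z :: "'a::cstar_algebra"
  assumes z: "norm_pos z" and tz: "norm_pos (of_real t - z)"
  shows "norm z \<le> t"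
proof (rule field_le_epsilon)
  have t: "0 \<le> t" using norm_pos_add[OF z tz] by (simp add: norm_pos_of_real_iff)
  fix e :: real assume e: "0 < e"
  then have e3: "0 < e / 3" by simp
  obtain q where q: "norm_pos q" "q * q = z + of_real (e / 3)"
    "\<And>c. c * z = z * c \<Longrightarrow> c * q = q * c"
    using ex_sqrt_shift[OF z e3] by blast
  obtain r where r: "norm_pos r" "r * r = (of_real t - z) + of_real (e / 3)"
    "\<And>c. c * (of_real t - z) = (of_real t - z) * c \<Longrightarrow> c * r = r * c"
    using ex_sqrt_shift[OF tz e3] by blast
  have "z * q = q * z" by (rule q(3)) simp
  then have "q * (of_real t - z) = (of_real t - z) * q"
    by (simp add: left_diff_distrib right_diff_distrib of_real_commute)
  then have "q * r = r * q" by (rule r(3))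
  then have "(norm q)\<^sup>2 \<le> norm (q * q + r * r)"
    by (intro norm_square_le_norm_sum_squares norm_pos_adj q(1) r(1))
  also have "q * q + r * r = of_real (t + 2 * e / 3)"
    unfolding q(2) r(2) by (simp add: of_real_def flip: scaleR_add_left)
  also have "norm \<dots> = t + 2 * e / 3" using t e by (simp only: norm_of_real)
  finally have "norm (z + of_real (e / 3)) \<le> t + 2 * e / 3"
    using norm_selfadjoint_square[OF norm_pos_adj[OF q(1)]] by (simp only: q(2))
  then show "norm z \<le> t + e"
    using norm_triangle_ineq4[of "z + of_real (e / 3)" "of_real (e / 3)"] e
    by (simp only: norm_of_real add_diff_cancel)
qed

lemma norm_pos_antisym: "norm_pos x \<Longrightarrow> norm_pos (- x) \<Longrightarrow> x = (0::'a::cstar_algebra)"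
  using norm_le_of_norm_pos[of x 0] by simp

lemma norm_add_of_real:
  fixes z :: "'a::cstar_algebra"
  assumes z: "norm_pos z" and r: "0 \<le> r"
  shows "norm (z + of_real r) = norm z + r"
proof (rule antisym)
  show "norm (z + of_real r) \<le> norm z + r"
    using norm_triangle_ineq[of z "of_real r"] r by simp
  have "norm_pos (of_real (norm (z + of_real r)) - (z + of_real r))"
    by (intro norm_pos_of_real_minus) (simp_all add: adj_add norm_pos_adj[OF z])
  then have "norm_pos (of_real (norm (z + of_real r) - r) - z)"
    by (simp add: algebra_simps)
  from norm_le_of_norm_pos[OF z this] show "norm z + r \<le> norm (z + of_real r)" by simp
qed

lemma norm_pos_add_invertible:
  fixes z :: "'a::cstar_algebra"
  assumes "norm_pos z" "0 < e"
  shows "invertible_el (z + of_real e)"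
proof -
  obtain q where "invertible_el q" "q * q = z + of_real e"
    using ex_sqrt_shift[OF assms] by blast
  then show ?thesis
    by (metis (no_types, lifting) invertible_el_def mult.assoc mult_1_left)
qed

text \<open>If \<open>v\<close> inverts \<open>z\<close>, then
  \<open>z - of_real e = z * (1 - e *\<^sub>R v)\<close>, and for small \<open>e\<close> the second
  factor is a square commuting with \<open>z\<close>.\<close>

lemma norm_pos_minus_of_real:
  fixes z :: "'a::cstar_algebra"
  assumes z: "norm_pos z" and inv: "invertible_el z"
  obtains e where "0 < e" "norm_pos (z - of_real e)"
proof -
  obtain v where v: "z * v = 1" "v * z = 1" using inv by (auto simp: invertible_el_def)
  have "adj v * z = 1" "z * adj v = 1"
    using arg_cong[OF v(1), of adj] arg_cong[OF v(2), of adj]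
    by (simp_all add: adj_mult norm_pos_adj[OF z])
  then have adjv: "adj v = v" using v by (metis mult.assoc mult_1_left mult_1_right)
  define e where "e = 1 / (norm v + 1)"
  have e: "0 < e" by (simp add: e_def add_nonneg_pos)
  have "norm (e *\<^sub>R v) < 1" by (simp add: e_def add_nonneg_pos)
  then obtain y where y: "adj y = y" "(1 - y) * (1 - y) = 1 - e *\<^sub>R v"
    "\<And>c. c * (e *\<^sub>R v) = (e *\<^sub>R v) * c \<Longrightarrow> c * y = y * c"
    using ex_sqrt_one_minus[of "e *\<^sub>R v"] adjv by (metis adj_scaleR)
  have "z * y = y * z" by (rule y(3)) (simp add: v)
  then have "norm_pos (z * ((1 - y) * (1 - y)))"
    by (intro norm_pos_mult_square z) (simp_all add: adj_diff y(1) algebra_simps)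
  then have "norm_pos (z * (1 - e *\<^sub>R v))" by (simp only: y(2))
  then have "norm_pos (z - of_real e)" by (simp add: right_diff_distrib v of_real_def)
  then show ?thesis using that e by blast
qed

section \<open>Agreement of the norm description with spectral positivity\<close>

lemma norm_pos_imp_positive_el:
  fixes x :: "'a::cstar_algebra"
  assumes x: "norm_pos x"
  shows "positive_el x"
proof -
  have "z \<in> complex_of_real ` {0..}" if ni: "\<not> invertible_el (x - scaleC z 1)" for z
  proof -
    have "Im z = 0"
      using invertible_selfadjoint_minus_nonreal[OF norm_pos_adj[OF x]] ni by blast
    then have z: "z = complex_of_real (Re z)" by (simp add: complex_eq_iff)
    have "\<not> Re z < 0"
    proof
      assume "Re z < 0"
      then have "invertible_el (x + of_real (- Re z))" by (intro norm_pos_add_invertible x) simp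
      moreover have "x + of_real (- Re z) = x - scaleC z 1"
        by (subst z) (simp only: scaleC_of_real, simp add: of_real_def)
      ultimately show False using ni by simp
    qed
    then show ?thesis using z by (intro image_eqI[of _ _ "Re z"]) auto
  qed
  then show ?thesis
    using norm_pos_adj[OF x] by (auto simp: positive_el_def spectrum_el_def)
qed

text \<open>The least shift \<open>Inf L\<close> making \<open>x\<close> norm-positive is attained.
  Were it positive, its negative would lie outside the spectrum, the shifted element would be
  invertible, and the gap at 0 would allow a smaller shift.\<close>

lemma positive_el_imp_norm_pos:
  fixes x :: "'a::cstar_algebra"
  assumes x: "positive_el x"
  shows "norm_pos x"
proof -
  have adjx: "adj x = x" using x by (simp add: positive_el_def)
  define L where "L = {l. norm_pos (x + of_real l)}"
  have L_bound: "- norm x \<le> l" if "l \<in> L" for l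
  proof -
    have "norm_pos ((x + of_real l) + (of_real (norm x) - x))"
      using that by (intro norm_pos_add[of "x + of_real l"] norm_pos_of_real_minus)
        (auto simp: L_def adjx)
    then have "norm_pos (of_real (l + norm x) :: 'a)" by simp
    then show ?thesis by (simp only: norm_pos_of_real_iff)
  qed
  then have bdd: "bdd_below L" by (auto simp: bdd_below_def)
  have "norm_pos (of_real (norm x) - (- x))"
    by (intro norm_pos_of_real_minus) (simp_all add: adjx)
  then have "norm x \<in> L" by (simp add: L_def add.commute)
  then have ne: "L \<noteq> {}" by blast
  have inf: "norm_pos (x + of_real (Inf L))"
  proof (rule norm_pos_closed[where C = 1])
    fix e :: real assume "0 < e"
    then obtain l where l: "l \<in> L" "l < Inf L + e"
      using cInf_lessD[OF ne, of "Inf L + e"] by auto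
    have "(x + of_real l) - (x + of_real (Inf L)) = (of_real (l - Inf L) :: 'a)" by simp
    then have "norm ((x + of_real l) - (x + of_real (Inf L))) = \<bar>l - Inf L\<bar>"
      by (metis norm_of_real)
    then show "\<exists>y. norm_pos y \<and> norm (y - (x + of_real (Inf L))) \<le> 1 * e"
      using l cInf_lower[OF l(1) bdd]
      by (intro exI[of _ "x + of_real l"]) (simp add: L_def)
  qed (simp_all add: adj_add adjx)
  have "Inf L \<le> 0"
  proof (rule ccontr)
    assume pos: "\<not> Inf L \<le> 0"
    have "complex_of_real (- Inf L) \<notin> spectrum_el x"
    proof
      assume "complex_of_real (- Inf L) \<in> spectrum_el x"
      then obtain r where "complex_of_real (- Inf L) = complex_of_real r" "0 \<le> r"
        using x by (auto simp: positive_el_def simp del: of_real_minus)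
      then show False using pos by (simp only: of_real_eq_iff)
    qed
    then have "invertible_el (x - scaleC (complex_of_real (- Inf L)) 1)"
      by (simp add: spectrum_el_def)
    then have "invertible_el (x + of_real (Inf L))"
      by (simp only: scaleC_of_real) (simp add: of_real_def)
    then obtain e where e: "0 < e" "norm_pos (x + of_real (Inf L) - of_real e)"
      using norm_pos_minus_of_real[OF inf] by blast
    then have "Inf L - e \<in> L" by (simp add: L_def algebra_simps)
    from cInf_lower[OF this bdd] show False using e(1) by simp
  qed
  then have "norm_pos ((x + of_real (Inf L)) + of_real (- Inf L))"
    by (intro norm_pos_add inf) (simp only: norm_pos_of_real_iff)
  then show ?thesis by simp
qed

section \<open>Uniqueness of positive square roots and of Moore-Penrose inverses\<close>

lemma norm_pos_sqrt_unique:
  fixes y z :: "'a::cstar_algebra"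
  assumes y: "norm_pos y" and z: "norm_pos z" and yz: "y * z = z * y" and sq: "y * y = z * z"
  shows "y = z"
proof -
  define d where "d = y - z"
  have d: "adj d = d" by (simp add: d_def adj_diff norm_pos_adj y z)
  have pos: "norm_pos (y * (d * d))" "norm_pos (z * (d * d))"
    by (intro norm_pos_mult_square y z d, simp add: d_def left_diff_distrib right_diff_distrib yz)+
  \<comment> \<open>Hence the positive elements \<open>y * (d * d)\<close> and
    \<open>z * (d * d)\<close> are negatives of each other and vanish; their difference is the cube
    of \<open>d\<close>.\<close>
  have "(y + z) * d = 0" by (simp add: d_def algebra_simps yz sq)
  then have "y * (d * d) + z * (d * d) = 0"
    by (metis distrib_right mult.assoc mult_zero_left)
  then have zd: "z * (d * d) = - (y * (d * d))" by (simp add: eq_neg_iff_add_eq_0 add.commute)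
  then have "y * (d * d) = 0" using norm_pos_antisym[OF pos(1)] pos(2) by simp
  then have "d * (d * d) = 0" using zd by (simp add: d_def left_diff_distrib)
  then have "(d * d) * (d * d) = 0" by (simp add: mult.assoc)
  then have "(norm (d * d))\<^sup>2 = 0"
    using norm_selfadjoint_square[of "d * d"] by (simp add: adj_mult d)
  then have "d = 0" using norm_selfadjoint_square[OF d] by simp
  then show ?thesis by (simp add: d_def)
qed

lemma mp_inv_eqI:
  fixes T X :: "'a::cstar_algebra"
  assumes X: "T * X * T = T" "X * T * X = X" "adj (T * X) = T * X" "adj (X * T) = X * T"
  shows "mp_inv T = X"
  unfolding mp_inv_def
proof (rule the_equality)
  fix Y assume Y: "T * Y * T = T \<and> Y * T * Y = Y \<and> adj (T * Y) = T * Y \<and> adj (Y * T) = Y * T"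
  have "T * Y = adj (T * X * (T * Y))" using X(1) Y by (metis mult.assoc)
  also have "\<dots> = T * Y * (T * X)" using X(3) Y by (metis adj_mult)
  also have "\<dots> = T * X" using Y by (metis mult.assoc)
  finally have TX: "T * Y = T * X" .
  have "Y * T = adj (Y * T * (X * T))" using X(1) Y by (metis mult.assoc)
  also have "\<dots> = X * T * (Y * T)" using X(4) Y by (metis adj_mult)
  also have "\<dots> = X * T" using Y by (metis mult.assoc)
  finally have "Y * T = X * T" .
  then show "Y = X" using TX X(2) Y by (metis mult.assoc)
qed (use X in simp)

subsection \<open>Projections and symmetries\<close>

lemma norm_projection_mult_le:
  fixes p x :: "'a::cstar_algebra"
  assumes "adj p = p" "p * p = p"
  shows "norm (p * x) \<le> norm x"
proof -
  have "norm p * norm p = norm p"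
    using norm_selfadjoint_square[OF assms(1)] by (simp add: assms(2) power2_eq_square)
  then have "norm p \<le> 1" by (metis mult_cancel_right1 norm_eq_zero order_refl zero_le_one)
  then show ?thesis
    by (meson norm_mult_ineq order_trans mult_left_le_one_le norm_ge_zero)
qed

lemma norm_mult_symmetry:
  fixes x u :: "'a::cstar_algebra"
  assumes "adj u = u" "u * u = 1"
  shows "norm (x * u) = norm x"
proof -
  have "(x * u) * adj (x * u) = x * adj x"
    by (simp add: adj_mult assms mult.assoc) (simp add: assms mult.assoc[symmetric])
  then have "(norm (x * u))\<^sup>2 = (norm x)\<^sup>2" by (metis norm_mult_adj)
  then show ?thesis by simp
qed

lemma norm_pos_minus_square:
  fixes k :: "'a::cstar_algebra"
  assumes "adj k = - k"
  shows "norm_pos (- (k * k))"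
proof -
  have "norm_pos (scaleC \<i> k * scaleC \<i> k)"
    by (rule norm_pos_square) (simp add: adj_scaleC assms scaleC_minus_left scaleC_minus_right)
  then show ?thesis by (simp add: scaleC_mult_scaleC scaleC_minus_left scaleC_one)
qed

lemma commute_left: "x * y = y * x \<Longrightarrow> x * (y * z) = y * (x * (z::'a::semigroup_mult))"
  by (metis mult.assoc)

lemma inverse_commute:
  fixes c :: "'a::monoid_mult"
  assumes "a * i = 1" "i * a = 1" "c * a = a * c"
  shows "c * i = i * c"
  using assms by (metis mult.assoc mult_1_left mult_1_right)

lemma adj_inverse:
  fixes a :: "'a::cstar_algebra"
  assumes "a * i = 1" "i * a = 1" "adj a = a"
  shows "adj i = i"
proof -
  have "adj i * a = 1" using arg_cong[OF assms(1), of adj] assms(3) by (simp add: adj_mult)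
  then show ?thesis using assms(1) by (metis mult.assoc mult_1_left mult_1_right)
qed

subsection \<open>The matched projection as a spectral projection\<close>

text \<open>Here \<open>a\<close> is the modulus of \<open>Q + adj Q - 1\<close>; it commutes with both \<open>Q\<close> and \<open>adj Q\<close>.\<close>

locale idempotent_modulus =
  fixes Q a i j :: "'a::cstar_algebra"
  assumes idem: "Q * Q = Q"
    and a_pos: "norm_pos a"
    and a_square: "a * a = (Q + adj Q - 1) * (Q + adj Q - 1)"
    and a_commute: "c * (a * a) = (a * a) * c \<Longrightarrow> c * a = a * c"
    and ai: "a * i = 1" "i * a = 1"
    and aj: "(a + 1) * j = 1" "j * (a + 1) = 1"
begin

abbreviation "R \<equiv> adj Q"
definition "h = Q + R - 1"
definition "k = Q - R"
definition "u = h * i"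
definition "P = Q * R * i * i"
definition "w = k * u"

lemma idem_adj: "R * R = R"
  using arg_cong[OF idem, of adj] by (simp add: adj_mult)

lemma idem_left: "Q * (Q * x) = Q * x" "R * (R * x) = R * x"
  by (simp_all add: mult.assoc[symmetric] idem idem_adj)

lemmas idem_simps = idem idem_adj idem_left

lemma adj_a: "adj a = a" by (rule norm_pos_adj[OF a_pos])
lemma adj_i: "adj i = i" by (rule adj_inverse[OF ai adj_a])

lemma adj_j: "adj j = j" by (rule adj_inverse[OF aj]) (simp add: adj_add adj_a)

lemma a_square_expand: "a * a = Q * R + R * Q - Q - R + 1"
  unfolding a_square by (simp add: algebra_simps idem_simps)

text \<open>Source of all commutation rules: \<open>Q\<close> commutes with \<open>a * a\<close>,
  hence with its root \<open>a\<close> by \<open>a_commute\<close>.\<close>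

lemma Q_a_square: "Q * (a * a) = Q * (R * Q)" "(a * a) * Q = Q * (R * Q)"
  unfolding a_square_expand by (simp_all add: algebra_simps idem_simps)

lemma aQ: "a * Q = Q * a"
  using a_commute[of Q] by (simp add: Q_a_square)

lemma aR: "a * R = R * a"
  using arg_cong[OF aQ, of adj] by (simp add: adj_mult adj_a)

lemma commutes_with_i: "a * c = c * a \<Longrightarrow> i * c = c * i"
  using inverse_commute[OF ai, of c] by simp

lemma commutes_with_j: "a * c = c * a \<Longrightarrow> j * c = c * j"
  using inverse_commute[OF aj, of c] by (simp add: algebra_simps)

lemmas iQ = commutes_with_i[OF aQ] and iR = commutes_with_i[OF aR]

text \<open>Partial fractions: \<open>1 / (a (a + 1)) = 1 / a - 1 / (a + 1)\<close>.\<close>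

lemma aji: "a * j = 1 - j" "j * a = 1 - j" "j * i = i - j" "i * j = i - j"
proof -
  show 1: "a * j = 1 - j" "j * a = 1 - j" using aj by (simp_all add: algebra_simps)
  have "i * (a * j) = i - i * j" unfolding 1 by (simp add: algebra_simps)
  then show 2: "i * j = i - j" by (simp add: mult.assoc[symmetric] ai algebra_simps)
  have "i * j = j * i" by (rule commutes_with_i) (simp add: 1)
  then show "j * i = i - j" using 2 by simp
qed

lemma ai_left: "a * (i * x) = x" "i * (a * x) = x"
  by (simp_all add: mult.assoc[symmetric] ai)

lemmas QR_simps = idem_simps aQ aR iQ iR commute_left[OF aQ] commute_left[OF aR]
  commute_left[OF iQ] commute_left[OF iR] ai ai_left

lemma adj_P: "adj P = P"
  by (simp add: P_def adj_simps adj_i mult.assoc QR_simps)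

lemma QP: "Q * P = P" by (simp add: P_def mult.assoc QR_simps)

lemma PQ: "P * Q = Q"
proof -
  have "P * Q = (Q * (R * Q)) * (i * i)" by (simp add: P_def mult.assoc QR_simps)
  also have "\<dots> = Q" by (simp add: Q_a_square[symmetric] mult.assoc ai ai_left)
  finally show ?thesis .
qed

lemma PR: "P * R = P" using arg_cong[OF QP, of adj] by (simp add: adj_mult adj_P)
lemma RP: "R * P = R" using arg_cong[OF PQ, of adj] by (simp add: adj_mult adj_P)

lemma PP: "P * P = P"
  by (subst (2) P_def) (simp add: mult.assoc[symmetric] PQ, simp add: P_def)

lemma aP: "a * P = P * a" by (simp add: P_def mult.assoc QR_simps)
lemmas iP = commutes_with_i[OF aP] and jP = commutes_with_j[OF aP]

lemma P_left: "Q * (P * x) = P * x" "P * (Q * x) = Q * x" "P * (R * x) = P * x"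
  "R * (P * x) = R * x" "P * (P * x) = P * x"
  by (simp_all add: mult.assoc[symmetric] QP PQ PR RP PP)

lemmas P_simps = QP PQ PR RP PP P_left aP iP jP commute_left[OF aP] commute_left[OF iP]
  commute_left[OF jP] QR_simps

lemma P_a_square: "P * (a * a) = Q * R"
  by (simp add: P_def mult.assoc QR_simps)

lemma P_pos: "norm_pos P"
  using norm_pos_square[OF adj_P] by (simp add: PP)

lemma abs_adj: "abs_el R = P * a"
  unfolding abs_el_def sqrt_el_def adj_adj
proof (rule the_equality)
  have pos: "norm_pos (P * a)" by (intro norm_pos_mult P_pos a_pos) (simp add: aP)
  have sq: "(P * a) * (P * a) = Q * R" by (simp add: mult.assoc P_simps P_a_square)
  show "positive_el (P * a) \<and> P * a * (P * a) = Q * R"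
    using norm_pos_imp_positive_el[OF pos] sq by simp
  fix y assume y: "positive_el y \<and> y * y = Q * R"
  then have y_pos: "norm_pos y" and yy: "y * y = Q * R"
    by (auto intro: positive_el_imp_norm_pos)
  have adj_y: "adj y = y" by (rule norm_pos_adj[OF y_pos])
  \<comment> \<open>An arbitrary positive root \<open>y\<close> of \<open>Q * R\<close> is first
    shown to live on the range of \<open>P\<close>. Then \<open>y * (a * a)\<close> and
    \<open>(a * a) * y\<close> both equal the cube of \<open>y\<close>, so \<open>y\<close> commutes
    with \<open>a\<close> and root uniqueness applies.\<close>
  have "adj (y * (1 - P)) * (y * (1 - P)) = (1 - P) * (y * y) * (1 - P)"
    by (simp add: adj_simps adj_y adj_P mult.assoc)
  also have "\<dots> = 0" by (simp add: yy mult.assoc right_diff_distrib RP)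
  finally have "y * (1 - P) = 0" using cstar_identity[of "y * (1 - P)"] by simp
  then have yP: "y * P = y" by (simp add: right_diff_distrib)
  have Py: "P * y = y" using arg_cong[OF yP, of adj] by (simp add: adj_mult adj_P adj_y)
  have "y * (a * a) = y * (P * (a * a))" by (simp add: mult.assoc[symmetric] yP)
  also have "\<dots> = (y * y) * y" by (simp add: P_a_square yy[symmetric] mult.assoc)
  also have "\<dots> = (P * (a * a)) * y" by (simp add: P_a_square yy)
  also have "\<dots> = (a * a) * y" by (simp add: mult.assoc aP[symmetric]
        commute_left[OF aP[symmetric]] Py)
  finally have "y * a = a * y" by (rule a_commute)
  then have "y * (P * a) = (P * a) * y"
    by (metis mult.assoc yP Py aP)
  then show "y = P * a"
    by (rule norm_pos_sqrt_unique[OF y_pos pos]) (simp only: yy sq)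
qed

lemma mp_inv_abs: "mp_inv (P * a) = P * i"
  by (rule mp_inv_eqI) (simp_all add: mult.assoc P_simps adj_P)

text \<open>\<open>P\<close> commutes with \<open>a\<close>, so \<open>P * a + 1\<close> acts as
  \<open>a + 1\<close> on the range of \<open>P\<close> and as 1 on its complement.\<close>

lemma inv_abs_plus_one: "inv_el (P * a + 1) = P * j + (1 - P)"
  by (rule inv_el_eqI) (simp_all add: algebra_simps P_simps aji)

lemma matched_proj_eq: "matched_proj Q = (1/2) *\<^sub>R (1 + u)"
proof -
  \<comment> \<open>The outer factors absorb \<open>P\<close>, since \<open>R * P = R\<close> and
    \<open>P * Q = Q\<close>; what remains of the middle is \<open>i * j\<close>, which commutes
    with everything.\<close>
  have "(P * a + R) * (P * i) = (P * a + R) * i"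
    by (simp add: algebra_simps P_simps)
  moreover have "(P * j + (1 - P)) * (P * a + Q) = j * (P * a + Q)"
    by (simp add: algebra_simps P_simps commutes_with_j[OF aQ])
  ultimately have "(P * a + R) * (P * i) * (P * j + (1 - P)) * (P * a + Q)
      = (P * a + R) * i * (j * (P * a + Q))"
    by (simp only: mult.assoc)
  also have "\<dots> = (P * a + R) * (P * a + Q) * (j * i)"
    by (simp add: algebra_simps P_simps commutes_with_j[OF aQ]
        commute_left[OF commutes_with_j[OF aQ]] aji)
  \<comment> \<open>The product factors through \<open>a + 1\<close>, which cancels
    \<open>j\<close>.\<close>
  also have "(P * a + R) * (P * a + Q) = (a * a + h) + (h + 1) * a"
    by (simp add: algebra_simps P_simps P_a_square)
      (simp add: a_square_expand h_def algebra_simps QR_simps)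
  also have "\<dots> = (h + a) * (a + 1)"
    by (simp add: algebra_simps)
  also have "\<dots> * (j * i) = (h + a) * (((a + 1) * j) * i)"
    by (simp only: mult.assoc)
  also have "\<dots> = 1 + u"
    by (simp only: aj) (simp add: u_def distrib_right ai)
  finally show ?thesis
    by (simp add: matched_proj_def adj_adj abs_adj mp_inv_abs inv_abs_plus_one)
qed

subsection \<open>Norm computations\<close>

lemma adj_h: "adj h = h" by (simp add: h_def adj_simps)
lemma adj_k: "adj k = - k" by (simp add: k_def adj_simps)
lemma ah: "a * h = h * a" by (simp add: h_def algebra_simps aQ aR)
lemma ak: "a * k = k * a" by (simp add: k_def algebra_simps aQ aR)
lemma au: "a * u = u * a" by (simp add: u_def mult.assoc commute_left[OF ah] ai)
lemma hh: "h * h = a * a" by (simp add: a_square h_def)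
lemma hk: "h * k = - (k * h)" by (simp add: h_def k_def algebra_simps idem_simps)
lemma kk: "k * k = 1 - a * a" unfolding a_square_expand by (simp add: k_def algebra_simps idem_simps)
lemma ua: "u * a = h" by (simp add: u_def mult.assoc ai)

lemma adj_u: "adj u = u"
  by (simp add: u_def adj_simps adj_i adj_h commutes_with_i[OF ah])

lemma uu: "u * u = 1"
proof -
  have "u * u = (h * h) * (i * i)"
    by (simp add: u_def mult.assoc commute_left[OF commutes_with_i[OF ah]])
  then show ?thesis by (simp add: hh mult.assoc ai_left ai)
qed

lemma uk: "u * k = - (k * u)"
  by (simp add: u_def mult.assoc commutes_with_i[OF ak] commute_left[OF commutes_with_i[OF ak]])
    (simp add: mult.assoc[symmetric] hk)

text \<open>All four right-hand sides have the shape \<open>a * a + v * a + x * (v * a)\<close> with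
  \<open>v\<close> equal to \<open>u\<close> or \<open>- u\<close> and \<open>x\<close> equal to
  \<open>k\<close> or \<open>- k\<close>, so one compression argument covers every product.\<close>

lemma double_products:
  "2 *\<^sub>R (Q * R) = a * a + u * a + k * (u * a)"
  "2 *\<^sub>R (R * Q) = a * a + u * a - k * (u * a)"
  "2 *\<^sub>R ((1 - R) * (1 - Q)) = a * a - u * a - k * (u * a)"
  "2 *\<^sub>R ((1 - Q) * (1 - R)) = a * a - u * a + k * (u * a)"
  unfolding a_square_expand ua
  by (simp_all add: h_def k_def algebra_simps idem_simps scaleR_2)

section \<open>The bound \<open>a >= 1\<close> and norms of polynomials in \<open>a\<close>\<close>

lemma a_square_minus_one_pos: "norm_pos (a * a - 1)"
  using norm_pos_minus_square[OF adj_k] by (simp add: kk)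

lemma a_minus_one_pos: "norm_pos (a - 1)"
proof -
  have a1: "norm_pos (a + 1)"
    using norm_pos_add[OF a_pos, of 1] norm_pos_of_real_iff[of 1, where 'a = 'a] by simp
  have "norm_pos ((a + 1) * (j * j))"
    by (intro norm_pos_mult_square a1 adj_j) (simp add: aj)
  then have j: "norm_pos j" by (simp add: mult.assoc[symmetric] aj)
  have ja: "j * a = a * j" by (simp add: aji)
  have "norm_pos ((a * a - 1) * j)"
    by (intro norm_pos_mult a_square_minus_one_pos j)
      (simp add: left_diff_distrib right_diff_distrib mult.assoc ja commute_left[OF ja])
  moreover have "(a * a - 1) * j = a - 1" by (simp add: algebra_simps aji)
  ultimately show ?thesis by simp
qed

lemma norm_a_minus_one: "norm (a - 1) = norm a - 1"
proof (rule antisym)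
  have "norm_pos (of_real (norm a) - a)"
    by (rule norm_pos_of_real_minus) (simp_all add: adj_a)
  then have "norm_pos (of_real (norm a - 1) - (a - 1))" by simp
  then show "norm (a - 1) \<le> norm a - 1" by (rule norm_le_of_norm_pos[OF a_minus_one_pos])
  show "norm a - 1 \<le> norm (a - 1)" using norm_triangle_ineq2[of a 1] by simp
qed

lemma norm_a_square: "norm (a * a) = (norm a)\<^sup>2"
  by (rule norm_selfadjoint_square[OF adj_a])

lemma norm_a_square_minus_one: "norm (a * a - 1) = (norm a)\<^sup>2 - 1"
  using norm_add_of_real[OF a_square_minus_one_pos, of 1] by (simp add: norm_a_square)

lemma norm_a_square_minus_a: "norm (a * a - a) = norm a * (norm a - 1)"
proof (rule antisym)
  have "norm (a * a - a) = norm (a * (a - 1))" by (simp add: right_diff_distrib)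
  also have "\<dots> \<le> norm a * (norm a - 1)"
    using norm_mult_ineq[of a "a - 1"] by (simp add: norm_a_minus_one)
  finally show "norm (a * a - a) \<le> norm a * (norm a - 1)" .
  show "norm a * (norm a - 1) \<le> norm (a * a - a)"
    using norm_triangle_ineq2[of "a * a" a] by (simp add: norm_a_square power2_eq_square algebra_simps)
qed

text \<open>\<open>k\<close> intertwines the two spectral projections of a symmetry that anticommutes with it.\<close>

lemma norm_symmetry_compression:
  assumes v: "adj v = v" "v * v = 1" "a * v = v * a" "v * k = - (k * v)"
  shows "norm ((1/2) *\<^sub>R ((1 - v) * (a * a - a))) = norm a * (norm a - 1)"
proof -
  \<comment> \<open>Only \<open>s = 1\<close> and \<open>s = -1\<close> matter: they give the
    complementary spectral projections of \<open>v\<close>, which \<open>k\<close>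
    exchanges.\<close>
  define p where "p s = (1/2) *\<^sub>R (1 - s *\<^sub>R v)" for s :: real
  define c where "c = a * a - a"
  have adj_c: "adj c = c" by (simp add: c_def adj_simps adj_a)
  have adj_p: "adj (p s) = p s" for s by (simp add: p_def adj_simps v)
  have pc: "p s * c = c * p s" for s
    by (simp add: p_def c_def algebra_simps v(3) commute_left[OF v(3)])
  have adj_pc: "adj (p s * c) = p s * c" for s by (simp add: adj_mult adj_p adj_c pc)
  have kp: "k * p s = p (- s) * k" for s by (simp add: p_def algebra_simps v(4))
  have ka: "k * (a * j) = (a * j) * k"
    using commutes_with_j[OF ak] by (simp add: mult.assoc ak[symmetric]
        commute_left[OF ak[symmetric]])
  have vaj: "v * (a * j) = (a * j) * v"
    using commutes_with_j[OF v(3)] by (simp add: mult.assoc v(3)[symmetric]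
        commute_left[OF v(3)[symmetric]])
  have paj: "p s * (a * j) = (a * j) * p s" for s
    by (simp add: p_def left_diff_distrib right_diff_distrib vaj)
  \<comment> \<open>Factor \<open>a^2 - a = (a^2 - 1) * a / (a + 1)\<close>, where
    \<open>a^2 - 1\<close> is \<open>- (k * k)\<close>.\<close>
  have c_eq: "k * (k * (a * j)) = - c"
  proof -
    have "k * (k * (a * j)) = (1 - a * a) * (a * j)" by (simp only: mult.assoc[symmetric] kk)
    also have "\<dots> = - c" by (simp add: c_def algebra_simps aji)
    finally show ?thesis .
  qed
  \<comment> \<open>The two corners of \<open>c\<close> are the products, in opposite orders, of the
    same pair of elements.\<close>
  have le: "norm (p s * c) \<le> norm (p (- s) * c)" for s
  proof -
    have xy: "(p s * k) * (- (k * (a * j))) = p s * c"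
      by (simp add: mult.assoc c_eq)
    have "(- (k * (a * j))) * (p s * k) = - (k * ((a * j) * p s) * k)" by (simp add: mult.assoc)
    also have "\<dots> = - ((k * p s) * ((a * j) * k))"
      by (subst paj[symmetric]) (simp only: mult.assoc)
    also have "\<dots> = p (- s) * c" by (simp only: kp ka[symmetric]) (simp add: mult.assoc c_eq)
    finally have yx: "(- (k * (a * j))) * (p s * k) = p (- s) * c" .
    show ?thesis using norm_mult_commute_le[of "p s * k" "- (k * (a * j))"]
      by (simp only: xy yx adj_pc)
  qed
  have eq: "norm (p (- 1) * c) = norm (p 1 * c)" using le[of 1] le[of "- 1"] by simp
  have pp: "p 1 * p 1 = p 1" "p 1 * p (- 1) = 0"
    by (simp_all add: p_def algebra_simps v(2) flip: scaleR_add_left)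
  have sum: "p 1 * c + p (- 1) * c = c"
    by (simp add: p_def algebra_simps flip: scaleR_add_left)
  \<comment> \<open>The corners are orthogonal with sum \<open>c\<close> and have equal norm, so
    each already has the norm of \<open>c\<close>.\<close>
  have "(p 1 * c) * (p (- 1) * c) = (p 1 * p (- 1)) * (c * c)" by (metis mult.assoc pc)
  then have "norm (p 1 * c + p (- 1) * c) \<le> max (norm (p 1 * c)) (norm (p (- 1) * c))"
    by (intro norm_add_orthogonal_le adj_pc) (simp add: pp)
  then have "norm c \<le> norm (p 1 * c)" by (simp add: sum eq)
  moreover have "norm (p 1 * c) \<le> norm c" by (rule norm_projection_mult_le[OF adj_p pp(1)])
  ultimately have "norm (p 1 * c) = norm a * (norm a - 1)"
    using norm_a_square_minus_a by (simp add: c_def)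
  then show ?thesis by (simp add: p_def c_def)
qed

text \<open>\<open>1 - v\<close> annihilates \<open>1 + v\<close>: the term with \<open>x\<close>,
  which anticommutes with \<open>v\<close>, is off-diagonal and drops out, while \<open>v\<close>
  acts as -1 on the corner.\<close>

lemma symmetry_compression:
  assumes v: "v * v = 1" "a * v = v * a" and x: "a * x = x * a" "v * x = - (x * v)"
  shows "(1 - v) * (a * a + v * a + x * (v * a)) * (1 - v) = 2 *\<^sub>R ((1 - v) * (a * a - a))"
proof -
  have vx: "v * (x * y) = - (x * (v * y))" "v * (v * y) = y" for y
    by (simp_all add: mult.assoc[symmetric] v x)
  show ?thesis
    by (simp add: algebra_simps scaleR_2 v x vx commute_left[OF v(2)] commute_left[OF x(1)])
qed

lemma norm_compression:
  assumes v: "adj v = v" "v * v = 1" "a * v = v * a" "v * k = - (k * v)"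
    and x: "x = k \<or> x = - k"
    and yy: "2 *\<^sub>R (y * adj y) = a * a + v * a + x * (v * a)"
  shows "norm ((1/2) *\<^sub>R ((1 - v) * y)) = sqrt 2 / 2 * sqrt (norm a * (norm a - 1))"
proof -
  let ?t = "(1/2) *\<^sub>R ((1 - v) * y)"
  have "a * x = x * a" "v * x = - (x * v)" using x v(4) ak by auto
  from symmetry_compression[OF v(2,3) this]
  have "?t * adj ?t = (1/2) *\<^sub>R ((1/2) *\<^sub>R ((1 - v) * (a * a - a)))"
    unfolding yy[symmetric]
    by (simp add: adj_simps v(1) mult.assoc)
  then have "(norm ?t)\<^sup>2 = (1/2) * (norm a * (norm a - 1))"
    using norm_symmetry_compression[OF v]
    by (metis norm_mult_adj norm_scaleR abs_of_nonneg zero_le_divide_1_iff zero_le_numeral)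
  then have "norm ?t = sqrt ((1/2) * (norm a * (norm a - 1)))"
    by (simp add: real_sqrt_unique)
  also have "\<dots> = sqrt 2 / 2 * sqrt (norm a * (norm a - 1))"
    by (simp add: real_sqrt_mult real_sqrt_divide field_simps)
  finally show ?thesis .
qed

lemma norm_four_products:
  defines "m \<equiv> matched_proj Q"
  defines "c \<equiv> sqrt 2 / 2 * sqrt (norm a * (norm a - 1))"
  shows "norm ((1 - m) * Q) = c" "norm (Q * (1 - m)) = c"
    "norm ((1 - Q) * m) = c" "norm (m * (1 - Q)) = c"
proof -
  have m: "m = (1/2) *\<^sub>R (1 + u)" and m': "1 - m = (1/2) *\<^sub>R (1 - u)"
    using scaleR_half_double[of "1::'a"]
    by (simp_all add: m_def matched_proj_eq algebra_simps flip: scaleR_add_left)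
  have adj_m: "adj m = m" by (simp add: m adj_simps adj_u)
  have swap: "norm (x * y) = norm (adj y * adj x)" for x y :: 'a
    by (metis adj_mult norm_adj)
  have u: "adj u = u" "u * u = 1" "a * u = u * a" "u * k = - (k * u)"
    and nu: "adj (- u) = - u" "- u * - u = 1" "a * - u = - u * a" "- u * k = - (k * - u)"
    by (simp_all add: adj_u uu au uk)
  show "norm ((1 - m) * Q) = c"
    using norm_compression[OF u, of k Q] double_products(1) by (simp add: m' c_def)
  \<comment> \<open>The compression estimate needs the projection on the left, so
    \<open>Q * (1 - m)\<close> is treated through its adjoint.\<close>
  have "norm ((1 - m) * R) = c"
    using norm_compression[OF u, of "- k" R] double_products(2) by (simp add: m' c_def adj_adj)
  then show "norm (Q * (1 - m)) = c" by (simp add: swap[of Q] adj_simps adj_m)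
  show "norm (m * (1 - Q)) = c"
    using norm_compression[OF nu, of "- k" "1 - Q"] double_products(4)
    by (simp add: m c_def adj_simps)
  have "norm (m * (1 - R)) = c"
    using norm_compression[OF nu, of k "1 - R"] double_products(3)
    by (simp add: m c_def adj_simps)
  then show "norm ((1 - Q) * m) = c" by (simp add: swap[of "1 - Q"] adj_simps adj_m)
qed

section \<open>The difference between the matched projection and \<open>Q\<close>\<close>

lemma matched_proj_minus: "matched_proj Q - Q = (1/2) *\<^sub>R (u - u * a - k)"
proof -
  have "2 *\<^sub>R (matched_proj Q - Q) = u - u * a - k"
    unfolding ua by (simp add: matched_proj_eq h_def k_def scaleR_diff_right scaleR_2)
  then show ?thesis by (metis scaleR_half_double scaleR_2 scaleR_add_right)
qed

lemma norm_matched_proj_minus_square: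
  "norm ((matched_proj Q - Q) * (matched_proj Q - Q)) = (norm a - 1) / 2"
proof -
  \<comment> \<open>\<open>k\<close> anticommutes with \<open>u * (1 - a)\<close>, so the cross
    terms cancel, leaving \<open>(1 - a)^2 + (1 - a^2)\<close>.\<close>
  have "(u - u * a - k) * (u - u * a - k) = 2 *\<^sub>R (1 - a)"
  proof -
    have uk': "u * (k * x) = - (k * (u * x))" "u * (u * x) = x" for x
      by (simp_all add: mult.assoc[symmetric] uk uu)
    show ?thesis
      by (simp add: algebra_simps scaleR_2 uu uk uk' au ak kk
        commute_left[OF au] commute_left[OF ak])
  qed
  then have "(matched_proj Q - Q) * (matched_proj Q - Q) = (1/2) *\<^sub>R (1 - a)"
    by (simp add: matched_proj_minus)
  then show ?thesis using norm_a_minus_one by (simp add: norm_minus_commute)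
qed

lemma adj_w: "adj w = w" by (simp add: w_def adj_simps adj_u adj_k uk)

lemma ww: "w * w = a * a - 1"
proof -
  have "w * w = k * (u * k) * u" by (simp add: w_def mult.assoc)
  also have "\<dots> = - (k * k) * (u * u)" by (simp add: uk mult.assoc)
  finally show ?thesis by (simp add: uu kk)
qed

lemma aw: "a * w = w * a"
  by (simp add: w_def mult.assoc commute_left[OF ak] au)

lemma norm_w: "norm w = sqrt ((norm a)\<^sup>2 - 1)"
proof -
  have "(norm w)\<^sup>2 = (norm a)\<^sup>2 - 1"
    using norm_selfadjoint_square[OF adj_w] by (simp only: ww norm_a_square_minus_one)
  then show ?thesis by (metis norm_ge_zero real_sqrt_unique)
qed

text \<open>\<open>a + w\<close> and \<open>a - w\<close> are mutually inverse and conjugate under \<open>u\<close>, so the norm \<open>\<rho>\<close>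
  of both satisfies \<open>2 \<rho> a \<le> \<rho>\<^sup>2 + 1\<close>.\<close>

lemma norm_a_plus_w_ge: "norm a + sqrt ((norm a)\<^sup>2 - 1) \<le> norm (a + w)"
proof -
  define r where "r = norm (a + w)"
  have uw: "u * w = - (w * u)"
    by (simp add: w_def mult.assoc[symmetric] uk)
  have "u * (a + w) * u = a - w"
    by (simp add: algebra_simps au[symmetric] uw uu)
  moreover have "norm (u * (a + w) * u) = norm (a + w)"
  proof -
    have "norm (u * (a + w)) = norm ((a + w) * u)"
      by (metis adj_mult norm_adj adj_u adj_add adj_a adj_w)
    then show ?thesis by (simp add: norm_mult_symmetry[OF adj_u uu])
  qed
  ultimately have r': "norm (a - w) = r" by (simp add: r_def)
  have "norm ((a + w) + (a - w)) \<le> r + r"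
    using norm_triangle_ineq[of "a + w" "a - w"] by (simp add: r' r_def)
  moreover have "(a + w) + (a - w) = 2 *\<^sub>R a" by (simp add: scaleR_2)
  ultimately have ar: "norm a \<le> r" by simp
  \<comment> \<open>Both commuting factors are positive, and expanding with
    \<open>w * w = a * a - 1\<close> leaves no quadratic term in \<open>a\<close>.\<close>
  have "norm_pos ((of_real r - (a + w)) * (of_real r - (a - w)))"
  proof (rule norm_pos_mult)
    show "norm_pos (of_real r - (a + w))" "norm_pos (of_real r - (a - w))"
      by (intro norm_pos_of_real_minus; simp add: adj_simps adj_a adj_w r' r_def)+
    show "(of_real r - (a + w)) * (of_real r - (a - w))
        = (of_real r - (a - w)) * (of_real r - (a + w))"
      by (simp add: of_real_def algebra_simps aw)
  qed
  also have "(of_real r - (a + w)) * (of_real r - (a - w))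
      = of_real (r\<^sup>2 + 1) - of_real (2 * r) * a"
    by (simp add: of_real_def algebra_simps aw ww power2_eq_square)
      (simp add: mult.commute flip: scaleR_2)
  finally have "norm_pos (of_real (r\<^sup>2 + 1) - of_real (2 * r) * a)" .
  moreover have "norm_pos (of_real (2 * r) * a)"
    by (rule norm_pos_mult[OF _ a_pos of_real_commute])
      (simp only: norm_pos_of_real_iff, simp add: r_def)
  ultimately have "norm (of_real (2 * r) * a) \<le> r\<^sup>2 + 1" by (rule norm_le_of_norm_pos[rotated])
  moreover have "of_real (2 * r) * a = (2 * r) *\<^sub>R a" by (simp only: of_real_def) simp
  ultimately have "2 * r * norm a \<le> r\<^sup>2 + 1" by (simp add: r_def)
  \<comment> \<open>Complete the square; \<open>ar\<close> selects the nonnegative root.\<close>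
  then have "(norm a)\<^sup>2 - 1 \<le> (r - norm a)\<^sup>2" by (simp add: power2_diff algebra_simps)
  then have "sqrt ((norm a)\<^sup>2 - 1) \<le> r - norm a" using ar by (intro real_le_lsqrt) auto
  then show ?thesis by (simp add: r_def)
qed

text \<open>Right multiplication by the symmetry \<open>u\<close> preserves norms and reduces the
  claim to \<open>(a - 1) + w\<close>. The upper bound is the triangle inequality; the lower one
  shifts \<open>norm_a_plus_w_ge\<close> by 1.\<close>

lemma norm_matched_proj_minus:
  "norm (matched_proj Q - Q) = (norm a - 1 + sqrt ((norm a)\<^sup>2 - 1)) / 2"
proof -
  have "(u - u * a - k) * u = - ((a - 1) + w)"
    by (simp add: algebra_simps w_def uu au mult.assoc[symmetric])
  then have eq: "norm (u - u * a - k) = norm ((a - 1) + w)"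
    using norm_mult_symmetry[OF adj_u uu] by (metis norm_minus_cancel)
  have "norm ((a - 1) + w) \<le> norm a - 1 + sqrt ((norm a)\<^sup>2 - 1)"
    using norm_triangle_ineq[of "a - 1" w] by (simp add: norm_a_minus_one norm_w)
  moreover have "norm (a + w) - 1 \<le> norm ((a - 1) + w)"
    using norm_triangle_ineq2[of "a + w" 1] by (simp add: algebra_simps)
  ultimately have "norm ((a - 1) + w) = norm a - 1 + sqrt ((norm a)\<^sup>2 - 1)"
    using norm_a_plus_w_ge by linarith
  then show ?thesis by (simp add: matched_proj_minus eq)
qed

text \<open>With \<open>X = Q - P\<close>, both \<open>X X\<^sup>*\<close> and \<open>X\<^sup>* X\<close> are compressions of \<open>a\<^sup>2 - 1\<close>, to the range of
  \<open>P\<close> and its complement.\<close>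

lemma norm_eq_norm_a:
  assumes nonproj: "Q \<noteq> R"
  shows "norm Q = norm a" "1 < norm Q"
proof -
  have "Q \<noteq> 0" using nonproj by auto
  moreover have "norm Q \<le> norm Q * norm Q" using norm_mult_ineq[of Q Q] by (simp add: idem)
  ultimately have Q1: "1 \<le> norm Q" by simp
  define X where "X = Q - P"
  have X0: "X \<noteq> 0" using nonproj adj_P by (auto simp: X_def)
  have adjX: "adj X = R - P" by (simp add: X_def adj_diff adj_P)
  have b: "P * (a * a - 1) = X * adj X"
    unfolding adjX by (simp add: X_def algebra_simps P_simps P_a_square)
  have c: "(1 - P) * (a * a - 1) = adj X * X"
  proof -
    have "(1 - P) * (a * a - 1) = a * a - 1 - Q * R + P" by (simp add: algebra_simps P_a_square)
    also have "\<dots> = adj X * X"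
      unfolding adjX a_square_expand by (simp add: X_def algebra_simps P_simps)
    finally show ?thesis .
  qed
  have nb: "norm (P * (a * a - 1)) = (norm X)\<^sup>2"
    and nc: "norm ((1 - P) * (a * a - 1)) = (norm X)\<^sup>2"
    by (simp_all add: b c norm_mult_adj cstar_identity)
  have aaP: "(a * a - 1) * P = P * (a * a - 1)"
    by (simp add: algebra_simps aP commute_left[OF aP])
  have "(a * a - 1) = P * (a * a - 1) + (1 - P) * (a * a - 1)" by (simp add: left_diff_distrib)
  moreover have "norm (P * (a * a - 1) + (1 - P) * (a * a - 1))
      \<le> max (norm (P * (a * a - 1))) (norm ((1 - P) * (a * a - 1)))"
  proof (rule norm_add_orthogonal_le)
    show "adj (P * (a * a - 1)) = P * (a * a - 1)" by (simp add: b adj_simps)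
    show "adj ((1 - P) * (a * a - 1)) = (1 - P) * (a * a - 1)" by (simp add: c adj_simps)
    have "(P * (a * a - 1)) * ((1 - P) * (a * a - 1)) = (a * a - 1) * (P * (1 - P)) * (a * a - 1)"
      by (simp only: aaP[symmetric] mult.assoc)
    then show "(P * (a * a - 1)) * ((1 - P) * (a * a - 1)) = 0"
      by (simp add: right_diff_distrib PP)
  qed
  ultimately have "norm (a * a - 1) \<le> (norm X)\<^sup>2" by (simp add: nb nc)
  then have aX: "(norm a)\<^sup>2 \<le> 1 + (norm X)\<^sup>2" by (simp add: norm_a_square_minus_one)
  have "norm (Q * R) \<le> (norm a)\<^sup>2"
    using norm_projection_mult_le[OF adj_P PP, of "a * a"] by (simp add: P_a_square norm_a_square)
  then have Qa: "(norm Q)\<^sup>2 \<le> (norm a)\<^sup>2" by (simp add: norm_mult_adj)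
  have b_pos: "norm_pos (P * (a * a - 1))"
    by (intro norm_pos_mult P_pos a_square_minus_one_pos) (simp add: aaP)
  \<comment> \<open>Adding 1 to the positive corner raises its norm by exactly 1, and the result is
    the orthogonal sum of \<open>Q * R\<close> and \<open>1 - P\<close>.\<close>
  have "(norm X)\<^sup>2 + 1 = norm (P * (a * a - 1) + of_real 1)"
    by (simp only: norm_add_of_real[OF b_pos zero_le_one] nb)
  also have "P * (a * a - 1) + of_real 1 = Q * R + (1 - P)"
    by (simp add: right_diff_distrib P_a_square)
  also have "norm \<dots> \<le> max (norm (Q * R)) (norm (1 - P))"
    by (rule norm_add_orthogonal_le) (simp_all add: adj_simps adj_P right_diff_distrib mult.assoc RP)
  also have "\<dots> \<le> (norm Q)\<^sup>2"
  proof (rule max.boundedI)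
    show "norm (Q * R) \<le> (norm Q)\<^sup>2" by (simp only: norm_mult_adj order_refl)
    have "norm (1 - P) \<le> 1"
      using norm_projection_mult_le[of "1 - P" 1] by (simp add: adj_diff adj_P algebra_simps PP)
    also have "\<dots> \<le> (norm Q)\<^sup>2" using Q1 by simp
    finally show "norm (1 - P) \<le> (norm Q)\<^sup>2" .
  qed
  finally have XQ: "1 + (norm X)\<^sup>2 \<le> (norm Q)\<^sup>2" by simp
  \<comment> \<open>The three bounds close a cycle through \<open>1 + (norm X)^2\<close>. Strictness
    below comes from \<open>X0\<close>.\<close>
  have "(norm Q)\<^sup>2 = (norm a)\<^sup>2" using aX Qa XQ by linarith
  then show "norm Q = norm a" by simp
  have "1\<^sup>2 < (norm Q)\<^sup>2" using XQ X0 by (smt (verit) one_power2 zero_less_norm_iff zero_less_power)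
  then show "1 < norm Q" by (rule power2_less_imp_less) simp
qed

end

section \<open>Existence of the modulus, scalar inequalities and conclusion\<close>

lemma ex_idempotent_modulus:
  fixes Q :: "'a::cstar_algebra"
  assumes idem: "Q * Q = Q"
  obtains a i j where "idempotent_modulus Q a i j"
proof -
  have idem': "adj Q * adj Q = adj Q" using arg_cong[OF idem, of adj] by (simp add: adj_mult)
  define k where "k = Q - adj Q"
  have "norm_pos (- (k * k))" by (rule norm_pos_minus_square) (simp add: k_def adj_simps)
  \<comment> \<open>The shift 1 is exactly the summand in \<open>h^2 = 1 - k^2\<close>, and it makes
    the root invertible.\<close>
  then obtain a where a: "norm_pos a" "invertible_el a" "a * a = - (k * k) + of_real 1"
    "\<And>c. c * - (k * k) = - (k * k) * c \<Longrightarrow> c * a = a * c"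
    using ex_sqrt_shift[of "- (k * k)" 1] by (metis zero_less_one)
  obtain i where i: "a * i = 1" "i * a = 1" using a(2) by (auto simp: invertible_el_def)
  have "invertible_el (a + 1)" using norm_pos_add_invertible[OF a(1), of 1] by simp
  then obtain j where j: "(a + 1) * j = 1" "j * (a + 1) = 1" by (auto simp: invertible_el_def)
  have "idempotent_modulus Q a i j"
  proof
    show "a * a = (Q + adj Q - 1) * (Q + adj Q - 1)"
      by (simp add: a(3) k_def algebra_simps idem idem')
    show "c * a = a * c" if "c * (a * a) = a * a * c" for c
      using that by (intro a(4)) (simp add: a(3) algebra_simps)
  qed (fact idem a(1) i j)+
  then show ?thesis by (rule that)
qed

lemma norm_comparison:
  fixes n :: real
  assumes n: "1 < n"
  shows "sqrt 2 * ((n - 1) / 2) < sqrt 2 / 2 * sqrt (n * (n - 1))"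
    and "sqrt 2 / 2 * sqrt (n * (n - 1)) < (n - 1 + sqrt (n\<^sup>2 - 1)) / 2"
    and "(n - 1 + sqrt (n\<^sup>2 - 1)) / 2 < sqrt 2 * (sqrt 2 / 2 * sqrt (n * (n - 1)))"
proof -
  define s where "s = sqrt (n\<^sup>2 - 1)"
  have n2: "1 < n\<^sup>2" using n by simp
  have s: "0 < s" "s\<^sup>2 = n\<^sup>2 - 1" "s < n"
    using n2 n by (auto simp: s_def intro: real_less_lsqrt)
  \<comment> \<open>With \<open>0 < s < n\<close> this square lies strictly between
    \<open>n * (n - 1) / 2\<close> and \<open>n * (n - 1)\<close>.\<close>
  have sq: "((n - 1 + s) / 2)\<^sup>2 = (n - 1) * (n + s) / 2"
    using s(2) by (simp add: power2_eq_square field_simps)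
  have "n - 1 < sqrt (n * (n - 1))"
    using n by (intro real_less_rsqrt) (simp add: power2_eq_square)
  then show "sqrt 2 * ((n - 1) / 2) < sqrt 2 / 2 * sqrt (n * (n - 1))" by simp
  have "sqrt 2 / 2 * sqrt (n * (n - 1)) = sqrt (n * (n - 1) / 2)"
    by (simp add: real_sqrt_mult real_sqrt_divide field_simps)
  also have "\<dots> < (n - 1 + s) / 2"
    using n s by (intro real_less_lsqrt) (auto simp: sq)
  finally show "sqrt 2 / 2 * sqrt (n * (n - 1)) < (n - 1 + sqrt (n\<^sup>2 - 1)) / 2"
    by (simp add: s_def)
  have "(n - 1) * (n + s) < (n - 1) * (2 * n)" using n s by (intro mult_strict_left_mono) auto
  then have "((n - 1 + s) / 2)\<^sup>2 < n * (n - 1)"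
    unfolding sq by (simp add: field_simps)
  then have "(n - 1 + s) / 2 < sqrt (n * (n - 1))" by (rule real_less_rsqrt)
  moreover have "sqrt 2 * (sqrt 2 / 2 * sqrt (n * (n - 1))) = sqrt (n * (n - 1))"
    by (simp add: mult.assoc[symmetric])
  ultimately show "(n - 1 + sqrt (n\<^sup>2 - 1)) / 2 < sqrt 2 * (sqrt 2 / 2 * sqrt (n * (n - 1)))"
    by (simp only: s_def)
qed

theorem theorem5p14:
  fixes Q :: "'a::cstar_algebra"
  assumes idem: "Q * Q = Q" and nonproj: "Q \<noteq> adj Q"
  defines "m \<equiv> matched_proj Q"
  defines "c \<equiv> sqrt 2 / 2 * sqrt (norm Q * (norm Q - 1))"
  shows "norm ((1 - m) * Q) = c \<and> norm (Q * (1 - m)) = c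
       \<and> norm ((1 - Q) * m) = c \<and> norm (m * (1 - Q)) = c
       \<and> norm ((m - Q) * (m - Q)) = (norm Q - 1) / 2
       \<and> norm (m - Q) = (norm Q - 1 + sqrt ((norm Q)\<^sup>2 - 1)) / 2
       \<and> sqrt 2 * norm ((m - Q) * (m - Q)) < norm ((1 - m) * Q)
       \<and> norm ((1 - m) * Q) < norm (m - Q)
       \<and> norm (m - Q) < sqrt 2 * norm ((1 - m) * Q)"
proof -
  obtain a i j where "idempotent_modulus Q a i j" using ex_idempotent_modulus[OF idem] .
  then interpret idempotent_modulus Q a i j .
  note n = norm_eq_norm_a[OF nonproj]
  note eqs = norm_four_products norm_matched_proj_minus_square norm_matched_proj_minus
  show ?thesis
    unfolding m_def c_def eqs[folded n(1)] using norm_comparison[OF n(2)] by blast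
qed

end
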